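(* Let $G=(V,E)$ be a finite, connected graph with at least two vertices. For any $f:V \rightarrow \mathbb{R}$, $$ \max_{v \in V} f(v) \leq \max_{w \in \partial G} f(w) + \frac{2 \max_{v \in V} \deg(v)}{\min_{v \in V} \deg(v)} \cdot \mathrm{diam}(G)^2 \cdot \| Lf \|_{L^{\infty}(V \setminus \partial G)}.$$
   Context: Graphs are undirected and simple; $d(\cdot,\cdot)$ is the graph (shortest path) distance, $\deg(v)$ is the number of neighbors of $v$, and $\mathrm{diam}(G)=\max_{u,v\in V} d(u,v)$. The Graph Laplacian is $(Lf)(v) = \sum_{(v,w)\in E} (f(v)-f(w))$, the sum running over all neighbors $w$ of $v$. For $S \subseteq V$, $\|g\|_{L^\infty(S)} = \max_{v\in S}|g(v)|$ (equal to $0$ if $S=\emptyset$). The boundary $\partial G \subseteq V$ is defined as follows: $v \in \partial G$ if and only if there exists another vertex $w \in V$ such that $$ \frac{1}{\deg(v)} \sum_{(v,x) \in E} d(x,w) < d(v,w),$$ where this sum runs over all neighbors $x$ of $v$. *)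

theory Defs
  imports "Graph_Theory.Graph_Theory"
begin

text \<open>
  A finite undirected simple graph is a \<^locale>\<open>pair_graph\<close>: a finite, loop-free digraph with arcs
  given as ordered pairs and a symmetric arc relation, so that each undirected edge is represented
  by its two arcs. Hence the neighbours of \<open>v\<close> are the \<open>w\<close> with \<open>(v, w) \<in> parcs G\<close>, and
  \<open>deg(v)\<close> is \<^term>\<open>out_degree (with_proj G) v\<close>.
\<close>

abbreviation deg :: "'a pair_pre_digraph \<Rightarrow> 'a \<Rightarrow> nat" where
  "deg G v \<equiv> out_degree (with_proj G) v"

text \<open>
  The library's shortest-path cost for unit arc weights. It is \<open>\<infinity>\<close> for unreachable
  vertices, which \<^const>\<open>real_of_ereal\<close> maps to \<open>0\<close>; this case does not occur in connected graphs.
\<close>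

definition gdist :: "'a pair_pre_digraph \<Rightarrow> 'a \<Rightarrow> 'a \<Rightarrow> real" where
  "gdist G u v = real_of_ereal (wf_digraph.\<mu> (with_proj G) (\<lambda>_. 1) u v)"

definition diam :: "'a pair_pre_digraph \<Rightarrow> real" where
  "diam G = Max {gdist G u v | u v. u \<in> pverts G \<and> v \<in> pverts G}"

definition laplacian :: "'a pair_pre_digraph \<Rightarrow> ('a \<Rightarrow> real) \<Rightarrow> 'a \<Rightarrow> real" where
  "laplacian G f v = (\<Sum>w | (v, w) \<in> parcs G. f v - f w)"

definition boundary :: "'a pair_pre_digraph \<Rightarrow> 'a set" where
  "boundary G = {v \<in> pverts G. \<exists>w \<in> pverts G. w \<noteq> v \<and>
     1 / real (deg G v) * (\<Sum>x | (v, x) \<in> parcs G. gdist G x w) < gdist G v w}"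

definition linf_norm :: "'a set \<Rightarrow> ('a \<Rightarrow> real) \<Rightarrow> real" where
  "linf_norm S g = (if S = {} then 0 else Max ((\<lambda>v. \<bar>g v\<bar>) ` S))"

lemma gdist_eq_shortest_walk_length:
  assumes "pair_graph G" "Digraph_Component.connected (with_proj G)"
    and "u \<in> pverts G" "v \<in> pverts G"
  shows "\<exists>p. pre_digraph.awalk (with_proj G) u p v \<and> gdist G u v = real (length p) \<and>
           (\<forall>q. pre_digraph.awalk (with_proj G) u q v \<longrightarrow> length p \<le> length q)"
proof -
  interpret pair_graph G by fact
  have cost: "awalk_cost (\<lambda>_. 1) p = real (length p)" for p :: "('a \<times> 'a) list"
    by (induct p) auto
  have "strongly_connected (with_proj G)"
    by (rule symmetric_connected_imp_strongly_connected) (use assms(2) sym_arcs in auto)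
  then have r: "u \<rightarrow>\<^sup>*\<^bsub>with_proj G\<^esub> v" using assms by auto
  then obtain p0 where "awalk u p0 v" by (auto simp: reachable_awalk)
  then obtain p where p: "awalk u p v" "\<forall>q. awalk u q v \<longrightarrow> length p \<le> length q"
    using ex_has_least_nat[of "\<lambda>p. awalk u p v" p0 length] by blast
  have "\<mu> (\<lambda>_. 1) u v = ereal (real (length p))"
    unfolding \<mu>_def cost using p by (intro INF_eqI) auto
  then show ?thesis using p unfolding gdist_def by auto
qed

end

theory Submission
  imports Defs
begin

text \<open>
  Fix any vertex \<open>w\<close> and let \<open>d(x)\<close> be the distance from \<open>x\<close> to \<open>w\<close>. If \<open>v \<noteq> w\<close> lies outside the
  boundary, then by definition \<open>d\<close> does not decrease on average from \<open>v\<close> to its neighbours, that is,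
  \<open>(L d)(v) \<le> 0\<close>; at \<open>v = w\<close> this holds because \<open>d\<close> has its minimum there. Expanding
  \[ d(x)^2 - d(v)^2 = 2 d(v) (d(x) - d(v)) + (d(x) - d(v))^2 \]
  and summing over the neighbours \<open>x\<close> of \<open>v\<close>, the linear term contributes a nonnegative amount, and
  some neighbour lies at a different distance from \<open>w\<close> than \<open>v\<close>, so the quadratic term contributes
  at least \<open>1\<close>. Thus \<open>L (d^2) \<le> -1\<close> away from the boundary
  (lemma \<open>laplacian_gdist_squared_le\<close>).

  This makes \<open>d^2\<close> a barrier function. If \<open>c > \<parallel>L f\<parallel>\<close> on the complement of the boundary,
  then \<open>f + c d^2\<close> has negative Laplacian there, so its maximum can only be
  attained on the boundary, where \<open>d^2\<close> is at most the squared diameter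
  (lemma \<open>barrier_bound\<close>). Letting \<open>c\<close> decrease to \<open>\<parallel>L f\<parallel>\<close> yields the inequality with the constant
  \<open>1\<close> in place of the degree ratio, and twice the ratio of the maximal to the minimal degree is
  at least \<open>1\<close>.
\<close>

section \<open>Graph distance\<close>

lemma gdist_eq_0_iff:
  assumes "pair_graph G" "Digraph_Component.connected (with_proj G)"
    and "u \<in> pverts G" "v \<in> pverts G"
  shows "gdist G u v = 0 \<longleftrightarrow> u = v"
proof -
  interpret pair_graph G by fact
  obtain p where p: "awalk u p v" "gdist G u v = real (length p)"
      "\<forall>q. awalk u q v \<longrightarrow> length p \<le> length q"
    using gdist_eq_shortest_walk_length[OF assms] by blast
  show ?thesis
  proof
    assume "gdist G u v = 0"
    with p show "u = v" by (auto simp: awalk_def)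
  next
    assume "u = v"
    then have "awalk u [] v" using assms by (simp add: awalk_def)
    with p show "gdist G u v = 0" by force
  qed
qed

lemma gdist_nonneg:
  assumes "pair_graph G" "Digraph_Component.connected (with_proj G)"
    and "u \<in> pverts G" "v \<in> pverts G"
  shows "gdist G u v \<ge> 0"
  using gdist_eq_shortest_walk_length[OF assms] by auto

lemma one_le_gdist:
  assumes "pair_graph G" "Digraph_Component.connected (with_proj G)"
    and "u \<in> pverts G" "v \<in> pverts G" "u \<noteq> v"
  shows "gdist G u v \<ge> 1"
  using gdist_eq_shortest_walk_length[OF assms(1-4)] gdist_eq_0_iff[OF assms(1-4)] assms(5)
  by (auto simp: Suc_le_eq)

text \<open>The first arc of a shortest walk leads to such a neighbour.\<close>

lemma exists_closer_neighbour:
  assumes "pair_graph G" "Digraph_Component.connected (with_proj G)"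
    and "v \<in> pverts G" "w \<in> pverts G" "v \<noteq> w"
  shows "\<exists>x. (v, x) \<in> parcs G \<and> gdist G x w + 1 \<le> gdist G v w"
proof -
  interpret pair_graph G by fact
  obtain p where p: "awalk v p w" "gdist G v w = real (length p)"
    using gdist_eq_shortest_walk_length[OF assms(1-4)] by blast
  with assms(5) obtain e q where pq: "p = e # q" by (cases p) (auto simp: awalk_def)
  have e: "e \<in> parcs G" "fst e = v" and q: "awalk (snd e) q w"
    using p(1) pq by (auto simp: awalk_Cons_iff)
  have "snd e \<in> pverts G" using q by (auto simp: awalk_def)
  then obtain r where "awalk (snd e) r w" "gdist G (snd e) w = real (length r)"
      "\<forall>q. awalk (snd e) q w \<longrightarrow> length r \<le> length q"
    using gdist_eq_shortest_walk_length[OF assms(1,2) _ assms(4)] by blast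
  with q have "gdist G (snd e) w \<le> real (length q)" by simp
  with e pq p(2) show ?thesis by (intro exI[of _ "snd e"]) auto
qed

lemma exists_neighbour:
  assumes "pair_graph G" "Digraph_Component.connected (with_proj G)"
    and "card (pverts G) \<ge> 2" "v \<in> pverts G"
  shows "\<exists>x. (v, x) \<in> parcs G"
proof -
  have "\<not> pverts G \<subseteq> {v}"
    using assms(3) card_mono[of "{v}" "pverts G"] by auto
  then obtain w where "w \<in> pverts G" "v \<noteq> w" by blast
  then show ?thesis using exists_closer_neighbour[OF assms(1,2,4)] by blast
qed

lemma gdist_le_diam:
  assumes "pair_graph G" "u \<in> pverts G" "v \<in> pverts G"
  shows "gdist G u v \<le> diam G"
proof -
  interpret pair_graph G by fact
  have "finite ((\<lambda>(u, v). gdist G u v) ` (pverts G \<times> pverts G))" by simp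
  moreover have "(\<lambda>(u, v). gdist G u v) ` (pverts G \<times> pverts G) =
      {gdist G u v | u v. u \<in> pverts G \<and> v \<in> pverts G}" by auto
  ultimately show ?thesis unfolding diam_def using assms by (intro Max_ge) auto
qed

section \<open>Neighbourhoods and the Laplacian\<close>

lemma finite_neighbours:
  assumes "pair_graph G"
  shows "finite {x. (v, x) \<in> parcs G}"
proof -
  interpret pair_graph G by fact
  have "{x. (v, x) \<in> parcs G} \<subseteq> pverts G" using in_arcsD2 by auto
  then show ?thesis by (rule finite_subset) simp
qed

lemma deg_eq_card_neighbours:
  "deg G v = card {x. (v, x) \<in> parcs G}"
proof -
  have "out_arcs (with_proj G) v = Pair v ` {x. (v, x) \<in> parcs G}"
    by (auto simp: out_arcs_def)
  then show ?thesis by (simp add: out_degree_def card_image inj_on_def)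
qed

lemma deg_pos:
  assumes "pair_graph G" "Digraph_Component.connected (with_proj G)"
    and "card (pverts G) \<ge> 2" "v \<in> pverts G"
  shows "deg G v > 0"
proof -
  have "{x. (v, x) \<in> parcs G} \<noteq> {}" using exists_neighbour[OF assms] by blast
  then show ?thesis
    unfolding deg_eq_card_neighbours card_gt_0_iff using finite_neighbours[OF assms(1)] by blast
qed

lemma laplacian_add_cmult:
  "laplacian G (\<lambda>x. f x + c * h x) v = laplacian G f v + c * laplacian G h v"
proof -
  have "f v + c * h v - (f x + c * h x) = (f v - f x) + c * (h v - h x)" for x
    by (simp add: right_diff_distrib)
  then show ?thesis by (simp only: laplacian_def sum.distrib sum_distrib_left)
qed

lemma laplacian_nonneg_at_maximum:
  assumes "pair_graph G" "\<And>x. x \<in> pverts G \<Longrightarrow> g x \<le> g v"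
  shows "laplacian G g v \<ge> 0"
proof -
  interpret pair_graph G by fact
  have "g x \<le> g v" if "(v, x) \<in> parcs G" for x using assms(2) in_arcsD2[OF that] by blast
  then show ?thesis unfolding laplacian_def by (intro sum_nonneg) simp
qed

lemma abs_le_linf_norm:
  assumes "finite S" "v \<in> S"
  shows "\<bar>g v\<bar> \<le> linf_norm S g"
  using assms by (auto simp: linf_norm_def)

lemma linf_norm_nonneg:
  assumes "finite S"
  shows "linf_norm S g \<ge> 0"
proof (cases "S = {}")
  case False
  then obtain v where "v \<in> S" by blast
  then have "\<bar>g v\<bar> \<le> linf_norm S g" using assms by (rule abs_le_linf_norm[rotated])
  then show ?thesis by linarith
qed (simp add: linf_norm_def)

section \<open>The squared distance as a barrier\<close>

text \<open>For \<open>v \<noteq> w\<close> this is the negation of the boundary condition, multiplied by the degree of \<open>v\<close>.\<close>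

lemma laplacian_gdist_nonpos:
  assumes "pair_graph G" "Digraph_Component.connected (with_proj G)"
    and "card (pverts G) \<ge> 2"
    and v: "v \<in> pverts G - boundary G" and w: "w \<in> pverts G"
  shows "laplacian G (\<lambda>x. gdist G x w) v \<le> 0"
proof (cases "v = w")
  case True
  interpret pair_graph G by fact
  have "gdist G v w - gdist G x w \<le> 0" if "(v, x) \<in> parcs G" for x
    using gdist_nonneg[OF assms(1,2) in_arcsD2[OF that] w] gdist_eq_0_iff[OF assms(1,2) w w] True
    by simp
  then show ?thesis unfolding laplacian_def by (intro sum_nonpos) auto
next
  case False
  have "gdist G v w \<le> 1 / real (deg G v) * (\<Sum>x | (v, x) \<in> parcs G. gdist G x w)"
    using v w False by (auto simp: boundary_def not_less)
  then have "real (deg G v) * gdist G v w \<le> (\<Sum>x | (v, x) \<in> parcs G. gdist G x w)"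
    using deg_pos[OF assms(1-3), of v] v by (simp add: field_simps)
  then show ?thesis
    by (simp add: laplacian_def sum_subtractf deg_eq_card_neighbours)
qed

text \<open>
  Expanding the square of \<open>d(x) = d(v) + (d(x) - d(v))\<close> reduces this to the linear bound above
  together with one neighbour whose distance to \<open>w\<close> differs from that of \<open>v\<close>: a closer one if
  \<open>v \<noteq> w\<close>, and an arbitrary one otherwise.
\<close>

lemma laplacian_gdist_squared_le:
  assumes "pair_graph G" "Digraph_Component.connected (with_proj G)"
    and "card (pverts G) \<ge> 2"
    and v: "v \<in> pverts G - boundary G" and w: "w \<in> pverts G"
  shows "laplacian G (\<lambda>x. (gdist G x w)\<^sup>2) v \<le> - 1"
proof -
  interpret pair_graph G by fact
  let ?N = "{x. (v, x) \<in> parcs G}"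
  let ?d = "\<lambda>x. gdist G x w"
  have "\<exists>x\<in>?N. 1 \<le> \<bar>?d v - ?d x\<bar>"
  proof (cases "v = w")
    case True
    obtain x where x: "(v, x) \<in> parcs G"
      using exists_neighbour[OF assms(1-3)] v by blast
    then have "x \<noteq> w" "x \<in> pverts G" using True no_loops'[OF x] in_arcsD2[OF x] by auto
    then show ?thesis
      using x True gdist_eq_0_iff[OF assms(1,2) w w] one_le_gdist[OF assms(1,2) _ w, of x]
      by (intro bexI[of _ x]) auto
  next
    case False
    then obtain x where "(v, x) \<in> parcs G" "?d x + 1 \<le> ?d v"
      using exists_closer_neighbour[OF assms(1,2) _ w] v by blast
    then show ?thesis by (intro bexI[of _ x]) auto
  qed
  then obtain x where x: "x \<in> ?N" "1 \<le> \<bar>?d v - ?d x\<bar>" by blast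
  have "1 \<le> (?d v - ?d x)\<^sup>2" using x(2) abs_le_square_iff[of 1 "?d v - ?d x"] by simp
  also have "\<dots> \<le> (\<Sum>x\<in>?N. (?d v - ?d x)\<^sup>2)"
    using x(1) finite_neighbours[OF assms(1)] by (intro member_le_sum) auto
  finally have quadratic: "1 \<le> (\<Sum>x\<in>?N. (?d v - ?d x)\<^sup>2)" .
  have linear: "?d v * laplacian G ?d v \<le> 0"
    using laplacian_gdist_nonpos[OF assms] gdist_nonneg[OF assms(1,2) _ w] v
    by (intro mult_nonneg_nonpos) auto
  have "laplacian G (\<lambda>x. (?d x)\<^sup>2) v =
      2 * (?d v * laplacian G ?d v) - (\<Sum>x\<in>?N. (?d v - ?d x)\<^sup>2)"
    unfolding laplacian_def sum_distrib_left sum_subtractf[symmetric]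
    by (intro sum.cong) (auto simp: power2_eq_square algebra_simps)
  with quadratic linear show ?thesis by linarith
qed

section \<open>The maximum principle\<close>

text \<open>
  At a maximiser of \<open>f + c d^2\<close> the Laplacian of this function is nonnegative, which is impossible
  outside the boundary because \<open>c\<close> exceeds \<open>\<parallel>L f\<parallel>\<close> there. In particular the boundary is nonempty,
  so the maximum over it is a genuine one.
\<close>

lemma barrier_bound:
  assumes "pair_graph G" "Digraph_Component.connected (with_proj G)"
    and "card (pverts G) \<ge> 2"
    and c: "linf_norm (pverts G - boundary G) (laplacian G f) < c"
  shows "Max (f ` pverts G) \<le> Max (f ` boundary G) + c * (diam G)\<^sup>2"
proof -
  interpret pair_graph G by fact
  have nonempty: "pverts G \<noteq> {}" using assms(3) by auto
  then obtain w where w: "w \<in> pverts G" by blast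
  define g where "g = (\<lambda>x. f x + c * (gdist G x w)\<^sup>2)"
  have c_pos: "c > 0" using c linf_norm_nonneg[of "pverts G - boundary G" "laplacian G f"] by simp
  have "Max (g ` pverts G) \<in> g ` pverts G" using nonempty by (intro Max_in) auto
  then obtain v where v: "v \<in> pverts G" and "g v = Max (g ` pverts G)" by force
  then have v_max: "g x \<le> g v" if "x \<in> pverts G" for x using that by simp
  have "v \<in> boundary G"
  proof (rule ccontr)
    assume "v \<notin> boundary G"
    with v have v_int: "v \<in> pverts G - boundary G" by blast
    have "\<bar>laplacian G f v\<bar> < c"
      using abs_le_linf_norm[OF _ v_int, of "laplacian G f"] c by simp
    moreover have "c * laplacian G (\<lambda>x. (gdist G x w)\<^sup>2) v \<le> c * - 1"
      using laplacian_gdist_squared_le[OF assms(1-3) v_int w] c_pos by (intro mult_left_mono) auto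
    ultimately have "laplacian G g v < 0"
      unfolding g_def laplacian_add_cmult by linarith
    moreover have "laplacian G g v \<ge> 0"
      using assms(1) v_max by (rule laplacian_nonneg_at_maximum)
    ultimately show False by simp
  qed
  moreover have "finite (boundary G)" by (simp add: boundary_def)
  ultimately have f_v: "f v \<le> Max (f ` boundary G)" by simp
  have "(gdist G v w)\<^sup>2 \<le> (diam G)\<^sup>2"
    using gdist_le_diam[OF assms(1) v w] gdist_nonneg[OF assms(1,2) v w] by (intro power_mono)
  then have "c * (gdist G v w)\<^sup>2 \<le> c * (diam G)\<^sup>2" using c_pos by simp
  with f_v have g_v: "g v \<le> Max (f ` boundary G) + c * (diam G)\<^sup>2" by (simp add: g_def)
  have "f x \<le> Max (f ` boundary G) + c * (diam G)\<^sup>2" if "x \<in> pverts G" for x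
  proof -
    have "f x \<le> g x" using c_pos by (simp add: g_def)
    with v_max[OF that] g_v show ?thesis by linarith
  qed
  then show ?thesis using nonempty by simp
qed

lemma one_le_twice_degree_ratio:
  assumes "pair_graph G" "Digraph_Component.connected (with_proj G)"
    and "card (pverts G) \<ge> 2"
  shows "1 \<le> 2 * real (Max (deg G ` pverts G)) / real (Min (deg G ` pverts G))"
proof -
  interpret pair_graph G by fact
  have nonempty: "pverts G \<noteq> {}" using assms(3) by auto
  then have "Min (deg G ` pverts G) > 0"
    using deg_pos[OF assms] by simp
  moreover have "Min (deg G ` pverts G) \<le> Max (deg G ` pverts G)"
    using nonempty by (intro Min_le Max_in) auto
  ultimately show ?thesis by (simp add: field_simps)
qed

theorem theorem4:
  fixes G :: "'a pair_pre_digraph" and f :: "'a \<Rightarrow> real"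
  assumes "pair_graph G"
    and "Digraph_Component.connected (with_proj G)"
    and "card (pverts G) \<ge> 2"
  shows "Max (f ` pverts G) \<le> Max (f ` boundary G) +
    2 * real (Max (deg G ` pverts G)) / real (Min (deg G ` pverts G))
      * (diam G)\<^sup>2 * linf_norm (pverts G - boundary G) (laplacian G f)"
proof -
  interpret pair_graph G by fact
  let ?N = "linf_norm (pverts G - boundary G) (laplacian G f)"
  let ?D = "(diam G)\<^sup>2"
  have "Max (f ` pverts G) \<le> Max (f ` boundary G) + ?N * ?D"
  proof (rule field_le_epsilon)
    fix e :: real assume e: "e > 0"
    \<comment> \<open>The excess of \<open>c\<close> over the norm is scaled so that, multiplied by \<open>?D\<close>, it is at most \<open>e\<close>;
      the summand 1 keeps the denominator positive.\<close>
    define c where "c = ?N + e / (?D + 1)"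
    have D1: "?D + 1 > 0" by (simp add: add_nonneg_pos)
    have "?N < c" using e D1 by (simp add: c_def)
    from barrier_bound[OF assms this]
    have "Max (f ` pverts G) \<le> Max (f ` boundary G) + c * ?D" .
    moreover have "e / (?D + 1) * ?D \<le> e" using e D1 by (simp add: field_simps)
    ultimately show "Max (f ` pverts G) \<le> Max (f ` boundary G) + ?N * ?D + e"
      by (simp add: c_def distrib_right)
  qed
  also have "?N * ?D \<le>
      2 * real (Max (deg G ` pverts G)) / real (Min (deg G ` pverts G)) * (?D * ?N)"
    using mult_right_mono[OF one_le_twice_degree_ratio[OF assms], of "?D * ?N"]
      linf_norm_nonneg[of "pverts G - boundary G" "laplacian G f"]
    by (simp add: mult.commute)
  finally show ?thesis by (simp add: mult.assoc)
qed

end
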